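(* Let $H_n^{(3)}=\sum_{j=1}^n \frac{1}{j^3}$ (so $H_0^{(3)}=0$) and $(x)_k=x(x+1)\cdots(x+k-1)$ (with $(x)_0=1$). Then \[ \sum_{k=0}^{\infty}\Big(\frac{-1}{4}\Big)^k\frac{(\frac{1}{2})_k^5}{(1)_k^5}\bigg\{(20k^2+8k+1)H_{k}^{(3)}+\frac{8}{2k+1}\bigg\}=\frac{64\zeta(3)}{\pi^2}, \] where $\zeta(3)=\sum_{k=1}^\infty k^{-3}$.
   Context: $(x)_k$ denotes the rising factorial (shifted factorial). $H_n^{(3)}$ is the harmonic number of order 3. *)

theory Defs
  imports "HOL-Analysis.Analysis"
begin

definition harm3 :: "nat \<Rightarrow> real" where
  "harm3 n = (\<Sum>j=1..n. 1 / real j ^ 3)"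

(* The index is shifted so that the series starts at k = 1. *)
definition zeta3 :: real where
  "zeta3 = (\<Sum>k. 1 / real (Suc k) ^ 3)"

end

theory Submission
  imports Defs "HOL-Real_Asymp.Real_Asymp"
begin

text \<open>
  Replace three of the four factors $(1)_{n+k}$ in a WZ pair behind Guillera's series
  $\sum_n (-1/4)^n (1/2)_n^5 / (1)_n^5 \, (20 n^2 + 8 n + 1) = 8 / \pi^2$ by $(1 + \omega^i x)_{n+k}$,
  and three of the four factors $(1/2)_k$ by $(1/2 - \omega^i x)_k$, where $\omega$ is a primitive
  cube root of unity. Everything then depends on $x$ only through $t = x^3$, the remaining factor
  $(1/2)_n^6$ only to second order in $t$, and the pair survives if the certificate is corrected by
  $-t / (2 n + 1)$. Differentiating at $t = 0$ multiplies the terms by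
  $- (\sum_{j \le n+k} j^{-3} + \sum_{j < k} (j + 1/2)^{-3})$, so that the harmonic numbers
  appear on the line $k = 0$. As $k \to \infty$ the weight tends to $\zeta(3) + 7 \zeta(3)$, and only
  the row $n = 0$ contributes, with the factor $1 / \pi^2$ coming from Wallis' product.
\<close>

text \<open>\<open>fact (2 * n)\<close> stands for 4^n (1/2)_n n!: it hides the power of 4, cancels
  one of the six Pochhammer factors and supplies the fifth factorial on the line
  \<open>k = 0\<close>.\<close>

definition wz_term :: "nat \<Rightarrow> nat \<Rightarrow> real" where
  "wz_term n k = (- 1) ^ n * pochhammer (1 / 2) n ^ 6 * pochhammer (1 / 2) k ^ 4 /
     (fact (n + k) ^ 4 * fact (2 * n))"

text \<open>
  This is $\sum_{j \le n+k} j^{-3} + \sum_{j < k} (j + 1/2)^{-3}$, minus the logarithmic $t$-derivative.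
\<close>

definition wz_weight :: "nat \<Rightarrow> nat \<Rightarrow> real" where
  "wz_weight n k = harm3 (n + k) + 8 * harm3 (2 * k) - harm3 k"

text \<open>Like \<open>wz_V\<close>, this is minus the t-derivative at t = 0 of one half of the
  deformed pair. The factor \<open>n\<close> kills it on the row \<open>n = 0\<close>.\<close>

definition wz_P :: "nat \<Rightarrow> nat \<Rightarrow> real" where
  "wz_P n k = 2 * real n * (2 * real k + real n + 1 / 2) * wz_term n k * wz_weight n k"

definition wz_cert :: "nat \<Rightarrow> nat \<Rightarrow> real" where
  "wz_cert n k = (8 * real k ^ 2 + 24 * real k * real n + 4 * real k +
     20 * real n ^ 2 + 8 * real n + 1) / 8"

text \<open>The second summand comes from differentiating the correction -t / (2 n + 1) of the
  certificate; the overall sign is flipped.\<close>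

definition wz_V :: "nat \<Rightarrow> nat \<Rightarrow> real" where
  "wz_V n k = wz_cert n k * wz_term n k * wz_weight n k + wz_term n k / (2 * real n + 1)"

section \<open>Recurrences in both indices and the WZ identity\<close>

lemma wz_term_Suc_right:
  "wz_term n (Suc k) = wz_term n k * ((real k + 1 / 2) ^ 4 / (real n + real k + 1) ^ 4)"
  by (simp add: wz_term_def pochhammer_Suc power_mult_distrib add_ac mult_ac)

lemma wz_term_Suc_left:
  "wz_term (Suc n) k =
     - wz_term n k * ((real n + 1 / 2) ^ 5 / (4 * (real n + 1) * (real n + real k + 1) ^ 4))"
proof -
  have "(fact (2 * Suc n) :: real) = 4 * (real n + 1 / 2) * (real n + 1) * fact (2 * n)"
    by (simp add: algebra_simps)
  moreover have "real n + 1 / 2 \<noteq> 0" "real n + 1 \<noteq> 0" "real n + real k + 1 \<noteq> 0"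
    by linarith+
  moreover have "(fact (Suc n + k) :: real) = (real n + real k + 1) * fact (n + k)"
    by (simp add: algebra_simps)
  moreover have "pochhammer (1 / 2) (Suc n) = pochhammer (1 / 2) n * (real n + 1 / 2)"
    by (simp add: pochhammer_Suc add_ac)
  moreover have "(fact (2 * n) :: real) \<noteq> 0" "(fact (n + k) :: real) \<noteq> 0" by simp_all
  ultimately show ?thesis
    unfolding wz_term_def
    by (simp only: power_mult_distrib) (simp add: divide_simps, simp add: eval_nat_numeral algebra_simps)
qed

lemma harm3_Suc: "harm3 (Suc n) = harm3 n + 1 / (real n + 1) ^ 3"
  by (simp add: harm3_def add_ac)

lemma wz_weight_Suc_right:
  "wz_weight n (Suc k) = wz_weight n k + 1 / (real n + real k + 1) ^ 3 + 1 / (real k + 1 / 2) ^ 3"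
proof -
  have "8 * (1 / (2 * real k + 1) ^ 3) = 1 / (real k + 1 / 2) ^ 3"
  proof -
    have "(2 * real k + 1) ^ 3 = 8 * (real k + 1 / 2) ^ 3" by algebra
    then show ?thesis by simp
  qed
  \<comment> \<open>Scaled by 8, the new even cube equals the new term of \<open>harm3 k\<close> and
    cancels against it, so only the odd cube survives.\<close>
  moreover have "8 * (1 / (2 * real k + 2) ^ 3) = 1 / (real k + 1) ^ 3"
  proof -
    have "(2 * real k + 2) ^ 3 = 8 * (real k + 1) ^ 3" by algebra
    then show ?thesis by simp
  qed
  moreover have "harm3 (2 * Suc k) = harm3 (2 * k) + 1 / (2 * real k + 1) ^ 3 + 1 / (2 * real k + 2) ^ 3"
    by (simp add: harm3_Suc add_ac)
  ultimately show ?thesis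
    by (simp add: wz_weight_def harm3_Suc)
qed

lemma wz_weight_Suc_left:
  "wz_weight (Suc n) k = wz_weight n k + 1 / (real n + real k + 1) ^ 3"
  by (simp add: wz_weight_def harm3_Suc)

text \<open>After division by T = \<open>wz_term n k\<close> both sides are affine in the weight L.
  The coefficient of L is the undeformed WZ identity, the L-free part its t-derivative. In the
  variables y, z and a = y + z each becomes a polynomial identity.\<close>

lemma wz_identity: "wz_P n k - wz_P (Suc n) k = wz_V n k - wz_V n (Suc k)"
proof -
  define a where "a = real n + real k + 1"
  define y where "y = real n + 1 / 2"
  define z where "z = real k + 1 / 2"
  define T where "T = wz_term n k"
  define L where "L = wz_weight n k"
  define q where "q = wz_cert n k"
  define q' where "q' = wz_cert n (Suc k)"
  have pos: "a \<noteq> 0" "y \<noteq> 0" "z \<noteq> 0" "real n + 1 \<noteq> 0"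
    unfolding a_def y_def z_def by linarith+
  have ay: "a = y + z" by (simp add: a_def y_def z_def)
  have n: "real n = y - 1 / 2" "real k = z - 1 / 2" by (simp_all add: y_def z_def)
  have q: "q = z ^ 2 + 3 * y * z - 2 * z + 5 / 2 * y ^ 2 - 3 * y + 1"
    unfolding q_def wz_cert_def n by (simp add: field_simps power2_eq_square)
  have q': "q' = z ^ 2 + 3 * y * z + 5 / 2 * y ^ 2"
    unfolding q'_def wz_cert_def of_nat_Suc n by (simp add: field_simps power2_eq_square)
  \<comment> \<open>The coefficient of L, multiplied by a^4.\<close>
  have base: "2 * (y - 1 / 2) * (2 * z + y - 1) * a ^ 4 + (2 * z + y) * y ^ 5 / 2
      = q * a ^ 4 - q' * z ^ 4"
    unfolding q q' ay by (simp add: field_simps) algebra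
  \<comment> \<open>The L-free part, multiplied by 2 y a^7.\<close>
  have deriv: "(2 * z + y) * y ^ 6 = a ^ 7 - 2 * y * q' * z * (z ^ 3 + a ^ 3) - z ^ 4 * a ^ 3"
    unfolding q' ay by (simp add: field_simps) algebra
  have Pn: "wz_P n k = 2 * (y - 1 / 2) * (2 * z + y - 1) * T * L"
    unfolding wz_P_def T_def L_def n by simp
  have PS: "wz_P (Suc n) k = - ((2 * z + y) * y ^ 5 / (2 * a ^ 4)) * T * (L + 1 / a ^ 3)"
  proof -
    have "wz_P (Suc n) k = 2 * (real n + 1) * (2 * z + y) *
        (- T * (y ^ 5 / (4 * (real n + 1) * a ^ 4))) * (L + 1 / a ^ 3)"
      unfolding wz_P_def wz_term_Suc_left wz_weight_Suc_left T_def L_def y_def a_def z_def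
      by simp
    also have "2 * (real n + 1) * (2 * z + y) * (- T * (y ^ 5 / (4 * (real n + 1) * a ^ 4))) =
        - ((2 * z + y) * y ^ 5 / (2 * a ^ 4)) * T"
      using pos(1,4) by (simp add: divide_simps)
    finally show ?thesis by simp
  qed
  have Vn: "wz_V n k = q * T * L + T / (2 * y)"
    unfolding wz_V_def q_def T_def L_def y_def by simp
  have VS: "wz_V n (Suc k) = q' * (T * (z ^ 4 / a ^ 4)) * (L + 1 / a ^ 3 + 1 / z ^ 3)
      + T * (z ^ 4 / a ^ 4) / (2 * y)"
    unfolding wz_V_def wz_term_Suc_right wz_weight_Suc_right q'_def T_def L_def y_def a_def z_def
    by simp
  have "2 * (y - 1 / 2) * (2 * z + y - 1) + (2 * z + y) * y ^ 5 / (2 * a ^ 4)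
      = q - q' * (z ^ 4 / a ^ 4)" (is "?l1 = ?r1")
  proof -
    have "?l1 = (2 * (y - 1 / 2) * (2 * z + y - 1) * a ^ 4 + (2 * z + y) * y ^ 5 / 2) / a ^ 4"
      using pos by (simp add: add_divide_distrib)
    also have "\<dots> = ?r1"
      unfolding base using pos by (simp add: diff_divide_distrib)
    finally show ?thesis .
  qed
  moreover have "(2 * z + y) * y ^ 5 / (2 * a ^ 4) * (1 / a ^ 3) =
      1 / (2 * y) - q' * (z ^ 4 / a ^ 4) * (1 / a ^ 3 + 1 / z ^ 3) - (z ^ 4 / a ^ 4) / (2 * y)"
    (is "?l2 = ?r2")
  proof -
    have "?l2 = ((2 * z + y) * y ^ 6) / (2 * y * a ^ 7)"
      using pos by (simp add: divide_simps) (simp add: eval_nat_numeral)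
    also have "\<dots> = ?r2"
      unfolding deriv using pos by (simp add: divide_simps) algebra
    finally show ?thesis .
  qed
  ultimately have "T * L * ?l1 + T * ?l2 = T * L * ?r1 + T * ?r2" by simp
  then show ?thesis
    unfolding Pn PS Vn VS by (simp add: algebra_simps add_divide_distrib)
qed

text \<open>Summing \<open>wz_identity\<close> over the rectangle n < N, k < K telescopes in n on
  one side and in k on the other; the edge n = 0 contributes nothing because
  \<open>wz_P 0 k = 0\<close>.\<close>

lemma wz_sum:
  "(\<Sum>n<N. wz_V n 0) = (\<Sum>n<N. wz_V n K) - (\<Sum>k<K. wz_P N k)"
proof -
  have "(\<Sum>k<K. \<Sum>n<N. wz_P n k - wz_P (Suc n) k) = - (\<Sum>k<K. wz_P N k)"
    by (simp add: sum_lessThan_telescope'[of "\<lambda>n. wz_P n _"] wz_P_def[of 0] sum_negf)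
  moreover have "(\<Sum>k<K. \<Sum>n<N. wz_V n k - wz_V n (Suc k)) = (\<Sum>n<N. wz_V n 0 - wz_V n K)"
    by (subst sum.swap) (simp add: sum_lessThan_telescope'[of "wz_V _"])
  ultimately show ?thesis
    by (simp add: wz_identity sum_subtractf)
qed

section \<open>Harmonic numbers of order 3 and the weight\<close>

lemma summable_zeta3: "summable (\<lambda>k. 1 / real (Suc k) ^ 3)"
  using inverse_power_summable[of 3, where 'a = real]
  by (subst summable_Suc_iff) (simp add: inverse_eq_divide)

lemma harm3_altdef: "harm3 n = (\<Sum>k<n. 1 / real (Suc k) ^ 3)"
  by (induction n) (simp_all add: harm3_def)

lemma harm3_tendsto: "harm3 \<longlonglongrightarrow> zeta3"
  using summable_LIMSEQ[OF summable_zeta3] by (simp add: harm3_altdef[abs_def] zeta3_def)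

lemma harm3_mono: "m \<le> n \<Longrightarrow> harm3 m \<le> harm3 n"
  unfolding harm3_altdef by (rule sum_mono2) auto

lemma harm3_nonneg: "0 \<le> harm3 n"
  unfolding harm3_altdef by (rule sum_nonneg) auto

lemma harm3_le_zeta3: "harm3 n \<le> zeta3"
  unfolding harm3_altdef zeta3_def by (rule sum_le_suminf[OF summable_zeta3]) auto

lemma wz_weight_tendsto: "wz_weight n \<longlonglongrightarrow> 8 * zeta3"
proof -
  have "(\<lambda>k. harm3 (n + k) + 8 * harm3 (2 * k) - harm3 k) \<longlonglongrightarrow> zeta3 + 8 * zeta3 - zeta3"
    by (intro tendsto_intros harm3_tendsto filterlim_compose[OF harm3_tendsto])
       real_asymp+
  then show ?thesis by (simp add: wz_weight_def[abs_def])
qed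

lemma abs_wz_weight_le: "\<bar>wz_weight n k\<bar> \<le> 9 * zeta3"
  using harm3_mono[of k "n + k"] harm3_nonneg[of "2 * k"] harm3_nonneg[of k]
    harm3_le_zeta3[of "n + k"] harm3_le_zeta3[of "2 * k"]
  by (simp add: wz_weight_def abs_le_iff)

section \<open>Decay of the rows with n \<ge> 1\<close>

lemma pochhammer_half_le_fact: "pochhammer (1 / 2 :: real) n \<le> fact n"
  unfolding pochhammer_fact pochhammer_prod by (intro prod_mono) auto

text \<open>The gain of k + 1 over n! k! \<le> (n + k)! is what yields the decay (k + 1)^-4 of the
  terms. It fails for n = 0 and k \<ge> 1, so row 0 needs exact asymptotics instead.\<close>

lemma fact_mult_fact_Suc_le: "n \<ge> 1 \<Longrightarrow> (fact n * fact (Suc k) :: nat) \<le> fact (n + k)"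
proof (induction n rule: nat_induct_at_least)
  case (Suc n)
  have "(fact (Suc n) * fact (Suc k) :: nat) = Suc n * (fact n * fact (Suc k))"
    by (simp only: fact_Suc of_nat_id mult_ac)
  also have "\<dots> \<le> Suc (n + k) * fact (n + k)" by (intro mult_mono Suc.IH) auto
  finally show ?case by (simp only: fact_Suc add_Suc of_nat_id)
qed simp

lemma abs_wz_term_le:
  assumes "n \<ge> 1"
  shows "\<bar>wz_term n k\<bar> \<le> (1 / 4) ^ n / (real k + 1) ^ 4"
proof -
  define x y F where "x = pochhammer (1 / 2 :: real) n" and "y = pochhammer (1 / 2 :: real) k"
    and "F = (fact (n + k) :: real)"
  have x: "0 < x" "x \<le> fact n" and y: "0 < y" "y \<le> fact k"
    by (simp_all add: x_def y_def pochhammer_pos pochhammer_half_le_fact)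
  have F: "0 < F" by (simp add: F_def)
  have "real (fact n * fact (Suc k)) \<le> real (fact (n + k))"
    using fact_mult_fact_Suc_le[OF assms] by (simp only: of_nat_le_iff)
  then have F': "fact n * fact k * (real k + 1) \<le> F" by (simp add: F_def algebra_simps)
  have "x * y * (real k + 1) \<le> fact n * fact k * (real k + 1)"
    using x y by (intro mult_mono) auto
  then have xy: "x * y * (real k + 1) \<le> F" using F' by linarith
  have "\<bar>wz_term n k\<bar> = x ^ 6 * y ^ 4 / (F ^ 4 * (4 ^ n * x * fact n))"
    using x y F
    by (simp add: wz_term_def abs_mult power_abs fact_double power_mult x_def y_def F_def)
  \<comment> \<open>Of the five factors x left after cancellation, four pair with F and one with n!,
    so that both quotients are at most 1.\<close>
  also have "\<dots> = (1 / 4) ^ n / (real k + 1) ^ 4 * (x / fact n) * ((x * y * (real k + 1)) / F) ^ 4"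
  proof -
    have "real k + 1 \<noteq> 0" by linarith
    then show ?thesis
      using x F by (simp add: power_mult_distrib power_divide) (simp add: eval_nat_numeral mult_ac)
  qed
  also have "\<dots> \<le> (1 / 4) ^ n / (real k + 1) ^ 4 * 1 * 1 ^ 4"
    using x y F xy by (intro mult_mono power_mono) auto
  finally show ?thesis by simp
qed

section \<open>Limits of the rows as k tends to infinity\<close>

lemma wz_term_zero_tendsto: "(\<lambda>k. real k ^ 2 * wz_term 0 k) \<longlonglongrightarrow> 1 / pi ^ 2"
proof -
  \<comment> \<open>Wallis' product in Gamma form: (1/2)_k / k! behaves like 1 / sqrt (pi k), and
    \<open>wz_term 0 k\<close> is its fourth power.\<close>
  have "(\<lambda>k. rGamma_series (1 / 2 :: real) k ^ 4) \<longlonglongrightarrow> rGamma (1 / 2) ^ 4"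
    by (intro tendsto_intros rGamma_series_LIMSEQ)
  moreover have "rGamma (1 / 2 :: real) ^ 4 = 1 / pi ^ 2"
  proof -
    have "sqrt pi ^ 4 = pi ^ 2"
      by (metis pi_ge_zero real_sqrt_pow2 power_mult[of "sqrt pi" 2 2, simplified])
    then show ?thesis
      by (simp add: rGamma_inverse_Gamma Gamma_one_half_real inverse_eq_divide power_divide)
  qed
  \<comment> \<open>\<open>rGamma_series\<close> has k + 1 Pochhammer factors. The denominator
    removes the surplus one, and k^4 turns k^-2 into k^2.\<close>
  moreover have "(\<lambda>k. (real k / (real k + 1 / 2)) ^ 4) \<longlonglongrightarrow> 1"
    by real_asymp
  ultimately have "(\<lambda>k. rGamma_series (1 / 2 :: real) k ^ 4 * (real k / (real k + 1 / 2)) ^ 4)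
      \<longlonglongrightarrow> 1 / pi ^ 2 * 1"
    by (intro tendsto_mult) simp_all
  moreover have "rGamma_series (1 / 2 :: real) k ^ 4 * (real k / (real k + 1 / 2)) ^ 4
      = real k ^ 2 * wz_term 0 k" if "k > 0" for k
  proof -
    have e: "exp (1 / 2 * ln (real k)) ^ 4 = real k ^ 2"
      using that by (simp flip: exp_of_nat_mult add: ln_powr powr_def[symmetric] exp_of_nat2_mult)
         (simp add: exp_double)
    have nz: "real k + 1 / 2 \<noteq> 0" by linarith
    have "rGamma_series (1 / 2 :: real) k =
        pochhammer (1 / 2) k * (real k + 1 / 2) / (fact k * exp (1 / 2 * ln (real k)))"
      by (simp add: rGamma_series_def pochhammer_Suc add_ac)
    then have "rGamma_series (1 / 2 :: real) k ^ 4 * (real k / (real k + 1 / 2)) ^ 4 =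
        pochhammer (1 / 2) k ^ 4 * (real k + 1 / 2) ^ 4 / (fact k ^ 4 * real k ^ 2) *
        (real k ^ 4 / (real k + 1 / 2) ^ 4)"
      by (simp only: power_divide power_mult_distrib e)
    also have "\<dots> = pochhammer (1 / 2) k ^ 4 / fact k ^ 4 * (real k ^ 4 / real k ^ 2)"
      using nz by simp
    also have "real k ^ 4 / real k ^ 2 = real k ^ 2"
      using that by (simp add: field_simps eval_nat_numeral)
    finally show ?thesis by (simp add: wz_term_def)
  qed
  ultimately show ?thesis
    by (subst tendsto_cong[where g = "\<lambda>k. rGamma_series (1 / 2 :: real) k ^ 4 * (real k / (real k + 1 / 2)) ^ 4"])
       (auto intro: eventually_mono[OF eventually_gt_at_top[of 0]])
qed

text \<open>On row 0 the certificate grows like k^2 and exactly balances the decay 1 / (pi k)^2 of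
  the term. On later rows its quadratic growth loses against (k + 1)^-4.\<close>

lemma wz_V_tendsto: "wz_V n \<longlonglongrightarrow> (if n = 0 then 8 * zeta3 / pi ^ 2 else 0)"
proof -
  have V: "wz_V n = (\<lambda>k. wz_cert n k * wz_term n k * wz_weight n k + wz_term n k * (1 / (2 * real n + 1)))"
    by (simp add: wz_V_def fun_eq_iff)
  show ?thesis
  proof (cases "n = 0")
    case True
    have "(\<lambda>k. real k ^ 2 * wz_term 0 k * (1 / real k ^ 2)) \<longlonglongrightarrow> 1 / pi ^ 2 * 0"
      by (intro tendsto_mult wz_term_zero_tendsto) real_asymp
    then have t: "wz_term 0 \<longlonglongrightarrow> 1 / pi ^ 2 * 0"
      by (rule Lim_transform_eventually[OF _ eventually_mono[OF eventually_gt_at_top[of 0]], simplified]) auto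
    have "(\<lambda>k. real k ^ 2 * wz_term 0 k * ((8 * real k ^ 2 + 4 * real k + 1) / (8 * real k ^ 2)))
        \<longlonglongrightarrow> 1 / pi ^ 2 * 1"
      by (intro tendsto_mult wz_term_zero_tendsto) real_asymp
    then have c: "(\<lambda>k. wz_cert 0 k * wz_term 0 k) \<longlonglongrightarrow> 1 / pi ^ 2 * 1"
      by (rule Lim_transform_eventually[OF _ eventually_mono[OF eventually_gt_at_top[of 0]]])
         (auto simp: wz_cert_def)
    have "wz_V 0 \<longlonglongrightarrow> 1 / pi ^ 2 * 1 * (8 * zeta3) + 1 / pi ^ 2 * 0 * (1 / (2 * real 0 + 1))"
      using V unfolding True by (simp only:) (intro tendsto_intros c t wz_weight_tendsto)
    then show ?thesis using True by simp
  next
    case False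
    then have bound: "\<bar>wz_term n k\<bar> \<le> (1 / 4) ^ n / (real k + 1) ^ 4" for k
      by (intro abs_wz_term_le) simp
    have "(\<lambda>k. (1 / 4) ^ n / (real k + 1) ^ 4) \<longlonglongrightarrow> 0"
      by real_asymp
    then have t: "wz_term n \<longlonglongrightarrow> 0"
      by (rule Lim_null_comparison[rotated]) (use bound in simp)
    have "(\<lambda>k. wz_cert n k * ((1 / 4) ^ n / (real k + 1) ^ 4)) \<longlonglongrightarrow> 0"
      unfolding wz_cert_def by real_asymp
    moreover have "\<bar>wz_cert n k * wz_term n k\<bar> \<le> wz_cert n k * ((1 / 4) ^ n / (real k + 1) ^ 4)" for k
    proof -
      have "0 \<le> wz_cert n k" by (simp add: wz_cert_def)
      then show ?thesis by (simp only: abs_mult abs_of_nonneg mult_left_mono[OF bound])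
    qed
    ultimately have c: "(\<lambda>k. wz_cert n k * wz_term n k) \<longlonglongrightarrow> 0"
      by (intro Lim_null_comparison[of "\<lambda>k. wz_cert n k * wz_term n k"]) simp_all
    have "wz_V n \<longlonglongrightarrow> 0 * (8 * zeta3) + 0 * (1 / (2 * real n + 1))"
      unfolding V by (intro tendsto_intros c t wz_weight_tendsto)
    then show ?thesis using False by simp
  qed
qed

section \<open>Boundary estimate and passage to the limit\<close>

lemma abs_sum_wz_P_le:
  assumes "N \<ge> 1"
  shows "\<bar>\<Sum>k<K. wz_P N k\<bar> \<le> 18 * zeta3 ^ 2 * (real N * (real N + 2) * (1 / 4) ^ N)"
proof -
  define c where "c = 18 * zeta3 * (real N * (real N + 2) * (1 / 4) ^ N)"
  have z: "0 \<le> zeta3" using harm3_le_zeta3[of 0] by (simp add: harm3_def)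
  have "\<bar>wz_P N k\<bar> \<le> c * (1 / real (Suc k) ^ 3)" for k
  proof -
    have "\<bar>wz_P N k\<bar> = 2 * real N * (2 * real k + real N + 1 / 2) * \<bar>wz_term N k\<bar> * \<bar>wz_weight N k\<bar>"
      by (simp add: wz_P_def abs_mult)
    \<comment> \<open>Here 2 k + N + 1/2 \<le> (N + 2) (k + 1) leaves a cube in the denominator, so
      that the sum over k is bounded uniformly in K.\<close>
    also have "\<dots> \<le> 2 * real N * ((real N + 2) * (real k + 1)) * ((1 / 4) ^ N / (real k + 1) ^ 4) * (9 * zeta3)"
      using z by (intro mult_mono abs_wz_term_le abs_wz_weight_le assms) (auto simp: algebra_simps)
    also have "\<dots> = c * (1 / real (Suc k) ^ 3)"
      by (simp add: c_def divide_simps) (simp add: eval_nat_numeral algebra_simps)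
    finally show ?thesis .
  qed
  then have "\<bar>\<Sum>k<K. wz_P N k\<bar> \<le> (\<Sum>k<K. c * (1 / real (Suc k) ^ 3))"
    by (intro order.trans[OF sum_abs sum_mono])
  also have "\<dots> = c * harm3 K" by (simp only: harm3_altdef sum_distrib_left)
  also have "\<dots> \<le> c * zeta3"
    using z by (intro mult_left_mono harm3_le_zeta3) (simp add: c_def)
  finally show ?thesis by (simp add: c_def power2_eq_square mult_ac)
qed

text \<open>First K tends to infinity with N fixed, where only row 0 survives and the bound on the
  boundary sum persists; then N tends to infinity and 4^-N kills that bound.\<close>

lemma wz_V_sums: "(\<lambda>n. wz_V n 0) sums (8 * zeta3 / pi ^ 2)"
proof -
  let ?l = "8 * zeta3 / pi ^ 2"
  have bound: "\<bar>(\<Sum>n<N. wz_V n 0) - ?l\<bar> \<le> 18 * zeta3 ^ 2 * (real N * (real N + 2) * (1 / 4) ^ N)"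
    if "N \<ge> 1" for N
  proof -
    have "(\<lambda>K. \<Sum>n<N. wz_V n K) \<longlonglongrightarrow> (\<Sum>n<N. if n = 0 then ?l else 0)"
      by (intro tendsto_sum wz_V_tendsto)
    also have "(\<Sum>n<N. if n = 0 then ?l else 0) = ?l" using that by simp
    finally have "(\<lambda>K. \<bar>(\<Sum>n<N. wz_V n 0) - (\<Sum>n<N. wz_V n K)\<bar>) \<longlonglongrightarrow> \<bar>(\<Sum>n<N. wz_V n 0) - ?l\<bar>"
      by (intro tendsto_intros)
    then show ?thesis
    proof (rule tendsto_upperbound)
      show "\<forall>\<^sub>F K in sequentially. \<bar>(\<Sum>n<N. wz_V n 0) - (\<Sum>n<N. wz_V n K)\<bar>
          \<le> 18 * zeta3 ^ 2 * (real N * (real N + 2) * (1 / 4) ^ N)"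
      proof (intro always_eventually allI)
        fix K
        show "\<bar>(\<Sum>n<N. wz_V n 0) - (\<Sum>n<N. wz_V n K)\<bar>
            \<le> 18 * zeta3 ^ 2 * (real N * (real N + 2) * (1 / 4) ^ N)"
          using abs_sum_wz_P_le[OF that, of K] wz_sum[of N K] by simp
      qed
    qed simp
  qed
  have "(\<lambda>N. 18 * zeta3 ^ 2 * (real N * (real N + 2) * (1 / 4) ^ N)) \<longlonglongrightarrow> 0"
    by real_asymp
  then have "(\<lambda>N. (\<Sum>n<N. wz_V n 0) - ?l) \<longlonglongrightarrow> 0"
    by (rule Lim_null_comparison[rotated])
       (auto intro!: eventually_mono[OF eventually_ge_at_top[of 1]] bound)
  then show ?thesis
    unfolding sums_def by (simp only: LIM_zero_iff)
qed

lemma wz_term_zero_right: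
  "wz_term n 0 = (- 1 / 4) ^ n * (pochhammer (1 / 2) n ^ 5 / pochhammer 1 n ^ 5)"
proof -
  have "pochhammer (1 / 2 :: real) n > 0" by (simp add: pochhammer_pos)
  moreover have "(- 1 / 4 :: real) ^ n = (- 1) ^ n / 4 ^ n" by (simp only: power_divide)
  ultimately show ?thesis
    by (simp add: wz_term_def fact_double power_mult pochhammer_fact[symmetric] divide_simps)
       (simp add: eval_nat_numeral)
qed

theorem theorem1p3:
  shows "(\<lambda>k::nat. (- 1 / 4 :: real) ^ k * (pochhammer (1 / 2) k ^ 5 / pochhammer 1 k ^ 5) *
            ((20 * real k ^ 2 + 8 * real k + 1) * harm3 k + 8 / (2 * real k + 1)))
         sums (64 * zeta3 / pi ^ 2)"
proof -
  \<comment> \<open>At k = 0 the weight is just \<open>harm3 n\<close>, and the factor 8 clears the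
    denominator of \<open>wz_cert\<close>.\<close>
  have "8 * wz_V n 0 = wz_term n 0 *
      ((20 * real n ^ 2 + 8 * real n + 1) * harm3 n + 8 / (2 * real n + 1))" for n
    by (simp add: wz_V_def wz_cert_def wz_weight_def harm3_def algebra_simps)
  then show ?thesis
    using sums_mult[OF wz_V_sums, of 8] by (simp only: wz_term_zero_right) simp
qed

end
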